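(* Let $\nu\in(1,2)$ and $\mu=\nu-1\in(0,1)$, let $N\ge 2$ be an integer, and let $y_1,\dots,y_{N-1}$ be points with $-1<y_1<\cdots<y_{N-1}<1$. Let $u$ be a real function on $[-1,1]$ with $u(-1)=u(1)=0$ whose left-sided Riemann-Liouville derivative ${}^{RL}_{-1}\mathcal{D}^{\nu}_x u$ is defined at the points $y_1,\dots,y_{N-1}$. Consider the Riemann-Liouville $\nu$-fractional Birkhoff interpolation problem: find $p\in\mathbb{S}^{\mu}_N$ such that $$p(1)=0,\qquad {}^{RL}_{-1}\mathcal{D}^{\nu}_x p(y_j)={}^{RL}_{-1}\mathcal{D}^{\nu}_x u(y_j),\quad j=1,\dots,N-1.$$ Then the interpolant $u_N^\nu$ of $u$ (that is, the solution $p=u_N^\nu$ of this problem) takes the form $$u_N^\nu(x)=\sum_{j=1}^{N-1}\left({}^{RL}_{-1}\mathcal{D}^{\nu}_x u(y_j)\right)B_j^\nu(x),$$ where $$B_j^\nu(x)=(x+1)^\mu\sum_{n=1}^{N-1}\widetilde\beta_{nj}\left(P_{n}^{(-\mu,\mu)}(x)-P_{n}^{(-\mu,\mu)}(1)\right),\qquad j=1,\dots,N-1,$$ with the coefficients $\widetilde\beta_{nj}$ satisfying $$\sum_{n=1}^{N-1}\widetilde\beta_{nj}\,\frac{\Gamma(n+1+\mu)}{\Gamma(n+1)}\,\frac{n+1}{2}\,P_{n-1}^{(1,1)}(y_i)=\delta_{ij},\qquad i,j=1,\dots,N-1.$$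
   Context: For $\nu\in(1,2)$ the left-sided Riemann-Liouville fractional derivative of order $\nu$ on $[-1,1]$ is $${}^{RL}_{-1}\mathcal{D}^{\nu}_x u(x)=\frac{1}{\Gamma(2-\nu)}\frac{d^2}{dx^2}\int_{-1}^x\frac{u(\xi)}{(x-\xi)^{\nu-1}}\,d\xi .$$ $\mathbb{P}_n$ is the set of all (real) algebraic polynomials of degree at most $n$, and $\mathbb{S}^{\mu}_N=(x+1)^\mu\,\mathbb{P}_{N-1}=\{(x+1)^\mu q(x): q\in\mathbb{P}_{N-1}\}$. $P_n^{(\alpha,\beta)}$ denotes the standard Jacobi polynomial of degree $n$ (normalized by $P_n^{(\alpha,\beta)}(1)=\frac{\Gamma(n+\alpha+1)}{n!\,\Gamma(\alpha+1)}$). $\delta_{ij}$ is the Kronecker delta. *)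

theory Defs
  imports "HOL-Analysis.Analysis" "HOL-Computational_Algebra.Polynomial"
begin

text \<open>
  A function on \<open>[-1,1]\<close> is represented by a total function \<open>real \<Rightarrow> real\<close> of which only the
  values on \<open>{-1..1}\<close> matter; the derivatives below are taken at interior points only.
\<close>

definition rl_integrand :: "real \<Rightarrow> (real \<Rightarrow> real) \<Rightarrow> real \<Rightarrow> real \<Rightarrow> real" where
  "rl_integrand \<nu> u x = (\<lambda>\<xi>. u \<xi> / (x - \<xi>) powr (\<nu> - 1))"

text \<open>
  The integral is the Henstock-Kurzweil one, which agrees with the Lebesgue integral and with the
  improper Riemann integral whenever one of these exists.
\<close>

definition rl_integral :: "real \<Rightarrow> (real \<Rightarrow> real) \<Rightarrow> real \<Rightarrow> real" where
  "rl_integral \<nu> u x = integral {-1..x} (rl_integrand \<nu> u x)"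

definition rl_deriv :: "real \<Rightarrow> (real \<Rightarrow> real) \<Rightarrow> real \<Rightarrow> real" where
  "rl_deriv \<nu> u x = 1 / Gamma (2 - \<nu>) * deriv (deriv (rl_integral \<nu> u)) x"

text \<open>
  The value \<open>rl_deriv \<nu> u x\<close> is meaningful only under the following condition: the integral exists
  and is differentiable in a neighbourhood of \<open>x\<close>, and its derivative is differentiable at \<open>x\<close>.
\<close>

definition rl_deriv_defined :: "real \<Rightarrow> (real \<Rightarrow> real) \<Rightarrow> real \<Rightarrow> bool" where
  "rl_deriv_defined \<nu> u x \<longleftrightarrow>
     (\<forall>\<^sub>F z in nhds x. rl_integrand \<nu> u z integrable_on {-1..z} \<and>
                       rl_integral \<nu> u differentiable at z) \<and>
     deriv (rl_integral \<nu> u) differentiable at x"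

definition frac_poly_space :: "real \<Rightarrow> nat \<Rightarrow> (real \<Rightarrow> real) set" where
  "frac_poly_space \<mu> N =
     {p. \<exists>q :: real poly. degree q \<le> N - 1 \<and> (\<forall>x\<in>{-1..1}. p x = (x + 1) powr \<mu> * poly q x)}"

text \<open>
  The hypergeometric form
  \<open>P\<^sub>n(x) = (\<alpha>+1)\<^sub>n / n! \<cdot> \<^sub>2F\<^sub>1(-n, n+\<alpha>+\<beta>+1; \<alpha>+1; (1-x)/2)\<close>, for \<open>\<alpha> > -1\<close>.
\<close>

definition jacobi_poly :: "real \<Rightarrow> real \<Rightarrow> nat \<Rightarrow> real poly" where
  "jacobi_poly \<alpha> \<beta> n = smult (pochhammer (\<alpha> + 1) n / fact n)
     (\<Sum>k\<le>n. smult (pochhammer (- real n) k * pochhammer (real n + \<alpha> + \<beta> + 1) k /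
                      (pochhammer (\<alpha> + 1) k * fact k))
                   ([:1/2, -1/2:] ^ k))"

lemma poly_jacobi_poly_1:
  assumes "\<alpha> > -1"
  shows "poly (jacobi_poly \<alpha> \<beta> n) 1 = Gamma (real n + \<alpha> + 1) / (fact n * Gamma (\<alpha> + 1))"
proof -
  have "poly (jacobi_poly \<alpha> \<beta> n) 1 = pochhammer (\<alpha> + 1) n / fact n *
    (\<Sum>k\<le>n. pochhammer (- real n) k * pochhammer (real n + \<alpha> + \<beta> + 1) k /
                      (pochhammer (\<alpha> + 1) k * fact k) * 0 ^ k)"
    by (simp add: jacobi_poly_def poly_sum poly_power)
  also have "\<dots> = pochhammer (\<alpha> + 1) n / fact n *
    (\<Sum>k\<in>{0}. pochhammer (- real n) k * pochhammer (real n + \<alpha> + \<beta> + 1) k /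
                      (pochhammer (\<alpha> + 1) k * fact k) * 0 ^ k)"
    by (intro arg_cong[where f = "\<lambda>t. pochhammer (\<alpha> + 1) n / fact n * t"] sum.mono_neutral_right) auto
  also have "\<dots> = pochhammer (\<alpha> + 1) n / fact n"
    by simp
  also have "pochhammer (\<alpha> + 1) n = Gamma (\<alpha> + 1 + real n) / Gamma (\<alpha> + 1)"
  proof (rule pochhammer_Gamma)
    show "\<alpha> + 1 \<notin> \<int>\<^sub>\<le>\<^sub>0"
      using assms by (auto elim!: nonpos_Ints_cases)
  qed
  finally show ?thesis
    by (simp add: add_ac)
qed

definition solves_birkhoff ::
    "real \<Rightarrow> nat \<Rightarrow> (nat \<Rightarrow> real) \<Rightarrow> (real \<Rightarrow> real) \<Rightarrow> (real \<Rightarrow> real) \<Rightarrow> bool" where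
  "solves_birkhoff \<nu> N y u p \<longleftrightarrow>
     p \<in> frac_poly_space (\<nu> - 1) N \<and> p 1 = 0 \<and>
     (\<forall>j\<in>{1..N-1}. rl_deriv_defined \<nu> p (y j) \<and> rl_deriv \<nu> p (y j) = rl_deriv \<nu> u (y j))"

definition birkhoff_coeffs ::
    "real \<Rightarrow> nat \<Rightarrow> (nat \<Rightarrow> real) \<Rightarrow> (nat \<Rightarrow> nat \<Rightarrow> real) \<Rightarrow> bool" where
  "birkhoff_coeffs \<mu> N y b \<longleftrightarrow>
     (\<forall>i\<in>{1..N-1}. \<forall>j\<in>{1..N-1}.
        (\<Sum>n=1..N-1. b n j * (Gamma (real n + 1 + \<mu>) / Gamma (real n + 1)) *
            ((real n + 1) / 2) * poly (jacobi_poly 1 1 (n - 1)) (y i))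
          = (if i = j then 1 else 0))"

definition birkhoff_basis ::
    "real \<Rightarrow> nat \<Rightarrow> (nat \<Rightarrow> nat \<Rightarrow> real) \<Rightarrow> nat \<Rightarrow> real \<Rightarrow> real" where
  "birkhoff_basis \<mu> N b j x =
     (x + 1) powr \<mu> *
     (\<Sum>n=1..N-1. b n j * (poly (jacobi_poly (-\<mu>) \<mu> n) x - poly (jacobi_poly (-\<mu>) \<mu> n) 1))"

end

theory Submission
  imports Defs "HOL-Computational_Algebra.Formal_Power_Series"
begin

text \<open>
  By the Beta integral, the fractional derivative sends \<open>(x+1)\<^sup>\<mu> (x+1)\<^sup>k\<close> to a multiple of
  \<open>(x+1)\<^sup>k\<^sup>-\<^sup>1\<close>, nonzero exactly for \<open>k > 0\<close>. So it acts on \<open>(x+1)\<^sup>\<mu> q(x)\<close> as a linear operator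
  on \<open>q\<close> that lowers the degree by one and has the constants as its kernel; \<open>q(1) = 0\<close> then makes the
  interpolant unique. Expanding the Jacobi polynomials at \<open>-1\<close> shows that the operator sends
  \<open>P\<^sub>n\<close> with parameters \<open>(-\<mu>,\<mu>)\<close> to a multiple of \<open>P\<^sub>n\<^sub>-\<^sub>1\<close> with parameters \<open>(1,1)\<close>. The coefficients
  exist because the latter form a graded basis, in which the Lagrange polynomials can be expanded.
\<close>

section \<open>Fractional derivative of (x+1)^\<mu> times a polynomial\<close>

lemma Gamma_real_nonzero:
  fixes x :: real
  assumes "0 < x"
  shows "Gamma x \<noteq> 0"
  using Gamma_real_pos[OF assms] by simp

text \<open>The substitution t = (\<xi>+1)/(z+1) maps \<open>{-1..z}\<close> onto the unit interval
  and leaves Euler's Beta integral. For a = \<mu>+k+1 the exponent on the right is the integer k+1,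
  so integrating (\<xi>+1)^\<mu> times a polynomial yields a polynomial in z.\<close>

lemma has_integral_powr_kernel:
  fixes a \<mu> z :: real
  assumes "0 < a" "\<mu> < 1" "-1 < z"
  shows "((\<lambda>\<xi>. (\<xi> + 1) powr (a - 1) / (z - \<xi>) powr \<mu>) has_integral
           Beta a (1 - \<mu>) * (z + 1) powr (a - \<mu>)) {-1..z}"
proof -
  define f where "f = (\<lambda>t. t powr (a - 1) * (1 - t) powr (1 - \<mu> - 1))"
  define m where "m = 1 / (z + 1)"
  have m: "m > 0" "m * (z + 1) = 1" using assms by (auto simp: m_def)
  have "(f has_integral Beta a (1 - \<mu>)) (cbox 0 1)"
    unfolding f_def using has_integral_Beta_real[of a "1 - \<mu>"] assms by simp
  moreover have "(\<lambda>x. 1 / m * x - 1 / m * m) ` cbox 0 1 = {-1..z}"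
    using m assms by (simp add: image_affinity_atLeastAtMost_diff m_def)
  ultimately have "((\<lambda>\<xi>. f (m * \<xi> + m)) has_integral (z + 1) * Beta a (1 - \<mu>)) {-1..z}"
    using has_integral_affinity[of f "Beta a (1 - \<mu>)" 0 1 m m] m assms by (simp add: m_def)
  \<comment> \<open>The integrand is homogeneous of degree a-1-\<mu> in \<xi>+1 and z-\<xi>; this
    factor undoes the rescaling.\<close>
  note has_integral_mult_right[OF this, of "(z + 1) powr (a - 1 - \<mu>)"]
  moreover have "(z + 1) powr (a - 1 - \<mu>) * ((z + 1) * Beta a (1 - \<mu>)) = Beta a (1 - \<mu>) * (z + 1) powr (a - \<mu>)"
    using assms powr_mult_base[of "z + 1" "a - 1 - \<mu>"] by (simp add: mult_ac)
  ultimately have "((\<lambda>\<xi>. (z + 1) powr (a - 1 - \<mu>) * f (m * \<xi> + m)) has_integral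
          Beta a (1 - \<mu>) * (z + 1) powr (a - \<mu>)) {-1..z}"
    by simp
  moreover have "(z + 1) powr (a - 1 - \<mu>) * f (m * \<xi> + m) = (\<xi> + 1) powr (a - 1) / (z - \<xi>) powr \<mu>"
    if "\<xi> \<in> {-1..z}" for \<xi>
  proof -
    have "m * \<xi> + m = (\<xi> + 1) / (z + 1)" "1 - (m * \<xi> + m) = (z - \<xi>) / (z + 1)"
      using assms by (auto simp: m_def field_simps)
    then have "f (m * \<xi> + m) = ((\<xi> + 1) / (z + 1)) powr (a - 1) * ((z - \<xi>) / (z + 1)) powr (- \<mu>)"
      by (simp add: f_def)
    also have "\<dots> = (\<xi> + 1) powr (a - 1) * (z - \<xi>) powr (- \<mu>) / ((z + 1) powr (a - 1) * (z + 1) powr (- \<mu>))"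
      using that assms by (simp add: powr_divide)
    also have "(z + 1) powr (a - 1) * (z + 1) powr (- \<mu>) = (z + 1) powr (a - 1 - \<mu>)"
      by (simp flip: powr_add)
    finally show ?thesis
      using assms by (simp add: powr_minus field_simps)
  qed
  ultimately show ?thesis
    by (rule has_integral_eq[rotated]) auto
qed

text \<open>Everything is in the variable s = x+1: the result is the integral of s^\<mu> r(s)
  against the kernel, with s^k going to a multiple of s^(k+1).\<close>

definition frac_pint :: "real \<Rightarrow> real poly \<Rightarrow> real poly" where
  "frac_pint \<mu> r = (\<Sum>k\<le>degree r. monom (coeff r k * Beta (\<mu> + real k + 1) (1 - \<mu>)) (Suc k))"

lemma coeff_frac_pint_Suc:
  "coeff (frac_pint \<mu> r) (Suc k) = coeff r k * Beta (\<mu> + real k + 1) (1 - \<mu>)"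
  by (auto simp: frac_pint_def coeff_sum coeff_eq_0)

lemma has_integral_rl_integrand:
  assumes "0 < \<mu>" "\<mu> < 1" and p: "\<And>x. x \<in> {-1..1} \<Longrightarrow> p x = (x + 1) powr \<mu> * poly r (x + 1)"
    and z: "-1 < z" "z \<le> 1"
  shows "(rl_integrand (\<mu> + 1) p z has_integral poly (frac_pint \<mu> r) (z + 1)) {-1..z}"
proof -
  have "((\<lambda>\<xi>. \<Sum>k\<le>degree r. coeff r k * ((\<xi> + 1) powr (\<mu> + real k + 1 - 1) / (z - \<xi>) powr \<mu>)) has_integral
      (\<Sum>k\<le>degree r. coeff r k *
        (Beta (\<mu> + real k + 1) (1 - \<mu>) * (z + 1) powr (\<mu> + real k + 1 - \<mu>)))) {-1..z}"
    using assms by (intro has_integral_sum has_integral_mult_right has_integral_powr_kernel) auto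
  moreover have "(z + 1) powr (\<mu> + real k + 1 - \<mu>) = (z + 1) ^ Suc k" for k
    using z by (subst powr_realpow[symmetric]) (auto simp: add_ac)
  moreover have "(\<Sum>k\<le>degree r. coeff r k * ((\<xi> + 1) powr (\<mu> + real k + 1 - 1) / (z - \<xi>) powr \<mu>))
      = rl_integrand (\<mu> + 1) p z \<xi>" if "\<xi> \<in> {-1..z}" for \<xi>
  \<comment> \<open>Splitting the power by \<open>powr_realpow\<close> requires a positive base. At
    the left endpoint both sides are 0, since \<open>0 powr a = 0\<close>.\<close>
  proof (cases "\<xi> = -1")
    case False
    then have "(\<xi> + 1) powr (\<mu> + real k) = (\<xi> + 1) powr \<mu> * (\<xi> + 1) ^ k" for k
      using that by (simp add: powr_add powr_realpow)
    then show ?thesis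
      using that z p[of \<xi>] unfolding rl_integrand_def
      by (simp add: poly_altdef[of r] sum_distrib_left sum_divide_distrib mult_ac)
  qed (use p[of "-1"] in \<open>simp add: rl_integrand_def\<close>)
  ultimately show ?thesis
    by (intro has_integral_eq[where g = "rl_integrand (\<mu> + 1) p z"])
       (auto simp: frac_pint_def poly_sum poly_monom mult_ac)
qed

text \<open>The Riemann-Liouville derivative of order \<mu>+1, read on the polynomial factor. The
  two compositions pass to powers of x+1, where \<open>frac_pint\<close> works, and back.\<close>

definition frac_pderiv :: "real \<Rightarrow> real poly \<Rightarrow> real poly" where
  "frac_pderiv \<mu> q =
     (smult (1 / Gamma (1 - \<mu>)) (pderiv (pderiv (frac_pint \<mu> (q \<circ>\<^sub>p [:-1, 1:]))))) \<circ>\<^sub>p [:1, 1:]"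

lemma pcompose_shift_cancel:
  fixes q :: "real poly"
  shows "(q \<circ>\<^sub>p [:1, 1:]) \<circ>\<^sub>p [:-1, 1:] = q" "(q \<circ>\<^sub>p [:-1, 1:]) \<circ>\<^sub>p [:1, 1:] = q"
  by (simp_all add: pcompose_assoc[symmetric] pcompose_pCons)

text \<open>On the open interval the integral coincides with a polynomial. Equality on an open set
  carries over both derivatives, and with them the well-definedness at x.\<close>

lemma rl_deriv_frac_poly:
  assumes \<mu>: "0 < \<mu>" "\<mu> < 1" and p: "\<And>x. x \<in> {-1..1} \<Longrightarrow> p x = (x + 1) powr \<mu> * poly q x"
    and x: "-1 < x" "x < 1"
  shows "rl_deriv_defined (\<mu> + 1) p x"
    and "rl_deriv (\<mu> + 1) p x = poly (frac_pderiv \<mu> q) x"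
proof -
  define s where "s = frac_pint \<mu> (q \<circ>\<^sub>p [:-1, 1:]) \<circ>\<^sub>p [:1, 1:]"
  let ?I = "rl_integral (\<mu> + 1) p"
  have p': "p x = (x + 1) powr \<mu> * poly (q \<circ>\<^sub>p [:-1, 1:]) (x + 1)" if "x \<in> {-1..1}" for x
    using p[OF that] by (simp add: poly_pcompose)
  have int: "(rl_integrand (\<mu> + 1) p z has_integral poly s z) {-1..z}" if "z \<in> {-1<..<1}" for z
    using has_integral_rl_integrand[OF \<mu> p', of z] that by (simp add: s_def poly_pcompose add_ac)
  have nhd: "\<forall>\<^sub>F z in nhds z'. z \<in> {-1<..<1}" if "z' \<in> {-1<..<1}" for z' :: real
    using that by (intro eventually_nhds_in_open) auto
  have I: "?I z = poly s z" if "z \<in> {-1<..<1}" for z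
    unfolding rl_integral_def using int[OF that] by (rule integral_unique)
  have I': "(?I has_field_derivative poly (pderiv s) z) (at z)" if "z \<in> {-1<..<1}" for z
    using has_field_derivative_transform_within_open[OF poly_DERIV[of s z], of "{-1<..<1}" ?I]
      that I by simp
  have I'': "(deriv ?I has_field_derivative poly (pderiv (pderiv s)) z) (at z)" if "z \<in> {-1<..<1}" for z
    using has_field_derivative_transform_within_open[OF poly_DERIV[of "pderiv s" z], of "{-1<..<1}" "deriv ?I"]
      that DERIV_imp_deriv[OF I'] by simp
  show "rl_deriv_defined (\<mu> + 1) p x"
    unfolding rl_deriv_defined_def
  proof
    show "\<forall>\<^sub>F z in nhds x. rl_integrand (\<mu> + 1) p z integrable_on {-1..z} \<and> ?I differentiable at z"
      by (rule eventually_mono[OF nhd])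
         (use x int I' in \<open>auto simp: integrable_on_def real_differentiable_def\<close>)
    show "deriv ?I differentiable at x"
      using I''[of x] x by (auto simp: real_differentiable_def)
  qed
  have "rl_deriv (\<mu> + 1) p x = 1 / Gamma (1 - \<mu>) * poly (pderiv (pderiv s)) x"
    using DERIV_imp_deriv[OF I''[of x]] x by (simp add: rl_deriv_def)
  also have "\<dots> = poly (frac_pderiv \<mu> q) x"
    by (simp add: frac_pderiv_def s_def pderiv_pcompose pderiv_pCons pcompose_smult)
  finally show "rl_deriv (\<mu> + 1) p x = poly (frac_pderiv \<mu> q) x" .
qed

text \<open>In powers of x+1 the operator is a weighted shift. Differentiating twice gives the
  factor (k+2)(k+1), which reduces the Gamma(k+3) = (k+2)! of the Beta function to k!;
  Gamma(1-\<mu>) cancels against the normalization.\<close>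

lemma coeff_frac_pderiv:
  assumes "0 < \<mu>" "\<mu> < 1"
  shows "coeff (frac_pderiv \<mu> q \<circ>\<^sub>p [:-1, 1:]) k =
           Gamma (\<mu> + real k + 2) / fact k * coeff (q \<circ>\<^sub>p [:-1, 1:]) (Suc k)"
proof -
  have "Gamma (1 - \<mu>) \<noteq> 0"
    using assms by (intro Gamma_real_nonzero) simp
  moreover have "Gamma (real k + 3) = (real k + 2) * (real k + 1) * fact k"
    using Gamma_fact[of "k + 2", where ?'a = real] by (simp add: algebra_simps)
  moreover have "real k + 1 \<noteq> 0" "real k + 2 \<noteq> 0"
    by linarith+
  ultimately show ?thesis
    unfolding frac_pderiv_def pcompose_shift_cancel
    by (simp add: coeff_pderiv coeff_frac_pint_Suc Beta_def add_ac)
qed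

section \<open>Linearity, degree and kernel of the operator\<close>

lemma poly_eqI_shift:
  fixes p q :: "real poly"
  assumes "\<And>k. coeff (p \<circ>\<^sub>p [:-1, 1:]) k = coeff (q \<circ>\<^sub>p [:-1, 1:]) k"
  shows "p = q"
  using assms pcompose_shift_cancel(2) poly_eqI by metis

context
  fixes \<mu> :: real
  assumes \<mu>: "0 < \<mu>" "\<mu> < 1"
begin

lemma frac_pderiv_add: "frac_pderiv \<mu> (p + q) = frac_pderiv \<mu> p + frac_pderiv \<mu> q"
  by (rule poly_eqI_shift) (simp add: coeff_frac_pderiv[OF \<mu>] pcompose_add ring_distribs)

lemma frac_pderiv_diff: "frac_pderiv \<mu> (p - q) = frac_pderiv \<mu> p - frac_pderiv \<mu> q"
  by (rule poly_eqI_shift) (simp add: coeff_frac_pderiv[OF \<mu>] pcompose_diff ring_distribs)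

lemma frac_pderiv_smult: "frac_pderiv \<mu> (smult c p) = smult c (frac_pderiv \<mu> p)"
  by (rule poly_eqI_shift) (simp add: coeff_frac_pderiv[OF \<mu>] pcompose_smult)

lemma frac_pderiv_const: "frac_pderiv \<mu> [:c:] = 0"
  by (rule poly_eqI_shift) (simp add: coeff_frac_pderiv[OF \<mu>])

lemma frac_pderiv_sum: "frac_pderiv \<mu> (\<Sum>i\<in>A. f i) = (\<Sum>i\<in>A. frac_pderiv \<mu> (f i))"
  using frac_pderiv_const[of 0]
  by (induction A rule: infinite_finite_induct) (simp_all add: frac_pderiv_add)

lemma degree_frac_pderiv: "degree (frac_pderiv \<mu> q) \<le> degree q - 1"
proof -
  have "degree (frac_pderiv \<mu> q \<circ>\<^sub>p [:-1, 1:]) \<le> degree q - 1"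
    by (rule degree_le) (auto simp: coeff_frac_pderiv[OF \<mu>] coeff_eq_0 degree_pcompose)
  then show ?thesis
    by (simp add: degree_pcompose)
qed

text \<open>The weights Gamma(\<mu>+k+2) are all nonzero, so every coefficient in powers of x+1
  except the constant one must vanish.\<close>

lemma frac_pderiv_eq_0D:
  assumes "frac_pderiv \<mu> q = 0"
  shows "degree q = 0"
proof -
  have "coeff (q \<circ>\<^sub>p [:-1, 1:]) (Suc k) = 0" for k
    using coeff_frac_pderiv[OF \<mu>, of q k] Gamma_real_nonzero[of "\<mu> + real k + 2"] \<mu> assms by auto
  then have "degree (q \<circ>\<^sub>p [:-1, 1:]) \<le> 0"
    by (intro degree_le) (metis gr0_implies_Suc)
  then show ?thesis
    by (simp add: degree_pcompose)
qed

end

section \<open>Jacobi polynomials expanded at -1 and their images under the operator\<close>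

text \<open>Expanding \<open>(1 - t)\<^sup>k\<close>, each coefficient is a terminating
  hypergeometric series at \<open>1\<close>, summed by Chu--Vandermonde.\<close>
lemma jacobi_reflection_sum:
  fixes \<alpha> \<beta> t :: real and n :: nat
  assumes "\<alpha> > -1" "\<beta> > -1"
  defines "s \<equiv> real n + \<alpha> + \<beta> + 1"
  shows "(-1) ^ n * pochhammer (\<beta> + 1) n *
           (\<Sum>k\<le>n. pochhammer (- real n) k * pochhammer s k / (pochhammer (\<beta> + 1) k * fact k) * (1 - t) ^ k) =
         pochhammer (\<alpha> + 1) n *
           (\<Sum>k\<le>n. pochhammer (- real n) k * pochhammer s k / (pochhammer (\<alpha> + 1) k * fact k) * t ^ k)"
proof -
  define d where "d k = pochhammer (- real n) k * pochhammer s k / (pochhammer (\<beta> + 1) k * fact k)" for k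
  have nz: "pochhammer (\<alpha> + 1) k \<noteq> 0" "pochhammer (\<beta> + 1) k \<noteq> 0"
      "pochhammer (\<beta> + 1 + real j) k \<noteq> 0" for j k
    using assms(1,2) pochhammer_pos[of "\<alpha> + 1" k] pochhammer_pos[of "\<beta> + 1" k]
      pochhammer_pos[of "\<beta> + 1 + real j" k] by auto
  have "(\<Sum>k\<le>n. d k * (1 - t) ^ k) = (\<Sum>k\<le>n. \<Sum>j\<le>k. d k * (real (k choose j) * (- t) ^ j))"
    using binomial_ring[of "- t" 1] by (simp add: sum_distrib_left)
  also have "\<dots> = (\<Sum>j\<le>n. \<Sum>k=j..n. d k * (real (k choose j) * (- t) ^ j))"
    by (simp add: sum.Sigma, rule sum.reindex_bij_witness[of _ prod.swap prod.swap]) auto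
  also have "\<dots> = (\<Sum>j\<le>n. (\<Sum>k=j..n. d k * real (k choose j)) * (- t) ^ j)"
    by (simp add: sum_distrib_right mult.assoc)
  finally have expand: "(\<Sum>k\<le>n. d k * (1 - t) ^ k) =
    (\<Sum>j\<le>n. (\<Sum>k=j..n. d k * real (k choose j)) * (- t) ^ j)" .
  \<comment> \<open>The identity is checked for each power of t separately. With n = j+m and k = j+i
    the inner sum becomes a series over i from 0 to m, with lower parameter c = \<beta>+1+j.\<close>
  have inner: "(-1) ^ n * pochhammer (\<beta> + 1) n * ((\<Sum>k=j..n. d k * real (k choose j)) * (- t) ^ j) =
      pochhammer (\<alpha> + 1) n *
        (pochhammer (- real n) j * pochhammer s j / (pochhammer (\<alpha> + 1) j * fact j) * t ^ j)"
    if "j \<le> n" for j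
  proof -
    define m where "m = n - j"
    have n: "n = j + m" using that by (simp add: m_def)
    define c where "c = \<beta> + 1 + real j"
    have "(\<Sum>k=j..n. d k * real (k choose j)) = (\<Sum>i=0..m. d (j + i) * real ((j + i) choose j))"
      using sum.shift_bounds_cl_nat_ivl[of "\<lambda>k. d k * real (k choose j)" 0 j m]
      by (simp add: n add_ac)
    also have "\<dots> = (\<Sum>i=0..m. pochhammer (- real n) j * pochhammer s j / (pochhammer (\<beta> + 1) j * fact j) *
        (pochhammer (s + real j) i * pochhammer (- real m) i / (of_nat (fact i) * pochhammer c i)))"
    proof (rule sum.cong[OF refl])
      fix i
      have "real ((j + i) choose j) = fact (j + i) / (fact j * fact i)"
        by (subst binomial_fact) auto
      moreover have "- real n + real j = - real m" by (simp add: n)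
      ultimately show "d (j + i) * real ((j + i) choose j) =
          pochhammer (- real n) j * pochhammer s j / (pochhammer (\<beta> + 1) j * fact j) *
          (pochhammer (s + real j) i * pochhammer (- real m) i / (of_nat (fact i) * pochhammer c i))"
        unfolding d_def c_def pochhammer_product'[of _ j i] by (simp add: ac_simps)
    qed
    also have "\<dots> = pochhammer (- real n) j * pochhammer s j / (pochhammer (\<beta> + 1) j * fact j) *
        (pochhammer (c - (s + real j)) m / pochhammer c m)"
    proof -
      have "\<forall>i\<in>{0..<m}. c \<noteq> - real i" using assms(2) by (auto simp: c_def)
      from Vandermonde_pochhammer[OF this, of "s + real j"] show ?thesis
        by (simp only: sum_distrib_left[symmetric])
    qed
    \<comment> \<open>Here c-(s+j) = -(n+\<alpha>). Reversing the m factors gives the sign and a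
      rising product that starts at n+\<alpha>-m+1 = \<alpha>+1+j.\<close>
    also have "pochhammer (c - (s + real j)) m = (-1) ^ m * pochhammer (\<alpha> + 1 + real j) m"
      using pochhammer_minus[of "real n + \<alpha>" m] by (simp add: c_def s_def n algebra_simps)
    finally have *: "(\<Sum>k=j..n. d k * real (k choose j)) =
        pochhammer (- real n) j * pochhammer s j / (pochhammer (\<beta> + 1) j * fact j) *
        ((-1) ^ m * pochhammer (\<alpha> + 1 + real j) m / pochhammer c m)" .
    have a: "pochhammer (\<alpha> + 1) n = pochhammer (\<alpha> + 1) j * pochhammer (\<alpha> + 1 + real j) m"
      and b: "pochhammer (\<beta> + 1) n = pochhammer (\<beta> + 1) j * pochhammer c m"
      by (simp_all add: n c_def pochhammer_product')
    have sgn: "(-1::real) ^ n * (-1) ^ m * (- t) ^ j = t ^ j"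
      by (cases "even j"; cases "even m") (simp_all add: n power_add)
    have "(-1) ^ n * pochhammer (\<beta> + 1) n * ((\<Sum>k=j..n. d k * real (k choose j)) * (- t) ^ j) =
       ((-1) ^ n * (-1) ^ m * (- t) ^ j) * pochhammer (\<alpha> + 1 + real j) m *
         (pochhammer (- real n) j * pochhammer s j) / fact j"
      unfolding * b using nz(2)[of j] nz(3)[of j m] by (simp add: c_def field_simps)
    then show ?thesis
      unfolding sgn a using nz(1)[of j] by (simp add: field_simps)
  qed
  have "(-1) ^ n * pochhammer (\<beta> + 1) n * (\<Sum>k\<le>n. d k * (1 - t) ^ k) =
     (\<Sum>j\<le>n. (-1) ^ n * pochhammer (\<beta> + 1) n * ((\<Sum>k=j..n. d k * real (k choose j)) * (- t) ^ j))"
    unfolding expand by (rule sum_distrib_left)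
  also have "\<dots> = (\<Sum>j\<le>n. pochhammer (\<alpha> + 1) n *
      (pochhammer (- real n) j * pochhammer s j / (pochhammer (\<alpha> + 1) j * fact j) * t ^ j))"
    by (rule sum.cong) (use inner in auto)
  finally show ?thesis
    by (simp add: d_def sum_distrib_left)
qed

text \<open>This is the symmetry P_n^(\<alpha>,\<beta>)(-x) = (-1)^n P_n^(\<beta>,\<alpha>)(x) on
  coefficients: expanding at -1 instead of 1 exchanges the parameters and adds a sign.\<close>

lemma coeff_jacobi_poly_shift:
  assumes "\<alpha> > -1" "\<beta> > -1"
  shows "coeff (jacobi_poly \<alpha> \<beta> n \<circ>\<^sub>p [:-1, 1:]) k =
    (-1) ^ n * pochhammer (\<beta> + 1) n / fact n *
      (pochhammer (- real n) k * pochhammer (real n + \<alpha> + \<beta> + 1) k /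
        (pochhammer (\<beta> + 1) k * fact k)) / 2 ^ k"
proof -
  define c where "c k = (-1) ^ n * pochhammer (\<beta> + 1) n / fact n *
      (pochhammer (- real n) k * pochhammer (real n + \<alpha> + \<beta> + 1) k /
        (pochhammer (\<beta> + 1) k * fact k)) / 2 ^ k" for k
  have "jacobi_poly \<alpha> \<beta> n \<circ>\<^sub>p [:-1, 1:] = (\<Sum>k\<le>n. monom (c k) k)"
  proof (rule iffD1[OF poly_eq_poly_eq_iff], rule ext)
    fix x
    \<comment> \<open>The shift replaces x by x-1, and (1-(x-1))/2 = 1-x/2; the reflection at t =
      1-x/2 then leaves powers of x/2.\<close>
    have "poly (jacobi_poly \<alpha> \<beta> n \<circ>\<^sub>p [:-1, 1:]) x = pochhammer (\<alpha> + 1) n *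
       (\<Sum>k\<le>n. pochhammer (- real n) k * pochhammer (real n + \<alpha> + \<beta> + 1) k /
          (pochhammer (\<alpha> + 1) k * fact k) * (1 - x / 2) ^ k) / fact n"
      by (simp add: jacobi_poly_def poly_pcompose poly_sum poly_power field_simps)
    also have "\<dots> = (\<Sum>k\<le>n. poly (monom (c k) k) x)"
      unfolding jacobi_reflection_sum[OF assms, of n "1 - x / 2", symmetric]
      by (simp add: poly_monom sum_distrib_left sum_divide_distrib power_divide mult_ac c_def)
    finally show "poly (jacobi_poly \<alpha> \<beta> n \<circ>\<^sub>p [:-1, 1:]) x = poly (\<Sum>k\<le>n. monom (c k) k) x"
      by (simp add: poly_sum)
  qed
  \<comment> \<open>Since (-n)_k = 0 for k > n, the closed form is valid for all k.\<close>
  moreover have "c k = 0" if "k > n"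
    using that by (simp add: c_def pochhammer_of_nat_eq_0_iff)
  ultimately show ?thesis
    unfolding c_def[symmetric] by (cases "k \<le> n") (auto simp: coeff_sum)
qed

lemma degree_jacobi_poly_le: "degree (jacobi_poly \<alpha> \<beta> n) \<le> n"
  unfolding jacobi_poly_def
proof (intro order.trans[OF degree_smult_le] degree_sum_le)
  fix k assume "k \<in> {..n}"
  then show "degree ([:1/2, -1/2 :: real:] ^ k) \<le> n"
    using degree_power_le[of "[:1/2, -1/2 :: real:]" k] by simp
qed auto

text \<open>A shift of the variable preserves the degree, and in the expansion at -1 the coefficient
  of index n is a product of nonvanishing Pochhammer symbols. So the degree is exactly n.\<close>

lemma coeff_jacobi_poly_nonzero:
  assumes "\<alpha> > -1" "\<beta> > -1" "\<alpha> + \<beta> > -1"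
  shows "coeff (jacobi_poly \<alpha> \<beta> n) n \<noteq> 0"
proof -
  let ?q = "jacobi_poly \<alpha> \<beta> n \<circ>\<^sub>p [:-1, 1:]"
  have "pochhammer (- real n) n \<noteq> 0"
    by (simp add: pochhammer_of_nat_eq_0_iff)
  moreover have "pochhammer (real n + \<alpha> + \<beta> + 1) n > 0" "pochhammer (\<beta> + 1) n > 0"
    using assms by (auto intro!: pochhammer_pos)
  ultimately have "coeff ?q n \<noteq> 0"
    by (simp add: coeff_jacobi_poly_shift[OF assms(1,2)])
  then have "n \<le> degree ?q"
    by (rule le_degree)
  then have "degree (jacobi_poly \<alpha> \<beta> n) = n"
    using degree_jacobi_poly_le[of \<alpha> \<beta> n] by (simp add: degree_pcompose)
  then show ?thesis
    using \<open>coeff ?q n \<noteq> 0\<close> by (metis coeff_0 leading_coeff_0_iff pcompose_0)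
qed

text \<open>Both sides are compared in powers of x+1. The weight Gamma(\<mu>+k+2) cancels the
  denominator (\<mu>+1)_(k+1), which is the purpose of the second parameter \<mu>. What remains has
  upper parameters 1-n and n+2, those of the polynomial of degree n-1 with parameters (1,1).\<close>

lemma frac_pderiv_jacobi_poly:
  assumes \<mu>: "0 < \<mu>" "\<mu> < 1" and n: "n \<ge> 1"
  shows "frac_pderiv \<mu> (jacobi_poly (-\<mu>) \<mu> n) =
    smult (Gamma (real n + 1 + \<mu>) / Gamma (real n + 1) * ((real n + 1) / 2)) (jacobi_poly 1 1 (n - 1))"
proof (rule poly_eqI_shift)
  fix k
  obtain m where m: "n = Suc m" using n by (cases n) auto
  have G: "Gamma (\<mu> + 1 + real j) = pochhammer (\<mu> + 1) j * Gamma (\<mu> + 1)" for j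
  proof -
    have "\<mu> + 1 \<notin> \<int>\<^sub>\<le>\<^sub>0" using \<mu> by (auto elim!: nonpos_Ints_cases)
    then show ?thesis
      using pochhammer_Gamma[of "\<mu> + 1" j] Gamma_eq_zero_iff[of "\<mu> + 1"] by (simp add: field_simps)
  qed
  have two: "pochhammer (2::real) j = fact (Suc j)" for j
    using pochhammer_rec[of "1::real" j] by (simp add: pochhammer_fact[symmetric])
  have nz: "pochhammer (\<mu> + 1) (Suc k) \<noteq> 0"
    using \<mu> pochhammer_pos[of "\<mu> + 1" "Suc k"] by simp
  have L: "coeff (frac_pderiv \<mu> (jacobi_poly (-\<mu>) \<mu> n) \<circ>\<^sub>p [:-1, 1:]) k =
      (pochhammer (\<mu> + 1) (Suc k) * Gamma (\<mu> + 1)) / fact k *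
      ((-1) ^ n * pochhammer (\<mu> + 1) n / fact n *
      (pochhammer (- real n) (Suc k) * pochhammer (real n + 1) (Suc k) /
        (pochhammer (\<mu> + 1) (Suc k) * fact (Suc k))) / 2 ^ Suc k)"
    using \<mu> G[of "Suc k"]
    by (subst coeff_frac_pderiv[OF \<mu>], subst coeff_jacobi_poly_shift) (auto simp: add_ac)
  also have "\<dots> = Gamma (\<mu> + 1) / fact k *
      ((-1) ^ n * pochhammer (\<mu> + 1) n / fact n *
      (pochhammer (- real n) (Suc k) * pochhammer (real n + 1) (Suc k) / fact (Suc k)) / 2 ^ Suc k)"
    using nz by (simp del: pochhammer_Suc)
  \<comment> \<open>Splitting off the first factor of each symbol yields the factor -n(n+1) and
    moves both upper parameters up by one.\<close>
  also have "pochhammer (- real n) (Suc k) = - real n * pochhammer (- real m) k"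
    by (subst pochhammer_rec) (simp add: m)
  also have "pochhammer (real n + 1) (Suc k) = (real n + 1) * pochhammer (real m + 3) k"
    by (subst pochhammer_rec) (simp add: m add_ac)
  finally have L': "coeff (frac_pderiv \<mu> (jacobi_poly (-\<mu>) \<mu> n) \<circ>\<^sub>p [:-1, 1:]) k =
      Gamma (\<mu> + 1) / fact k *
      ((-1) ^ n * pochhammer (\<mu> + 1) n / fact n *
      ((- real n * pochhammer (- real m) k) * ((real n + 1) * pochhammer (real m + 3) k) / fact (Suc k)) / 2 ^ Suc k)" .
  have R: "coeff (jacobi_poly 1 1 m \<circ>\<^sub>p [:-1, 1:]) k =
      (-1) ^ m * real n *
      (pochhammer (- real m) k * pochhammer (real m + 3) k / (fact (Suc k) * fact k)) / 2 ^ k"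
    using coeff_jacobi_poly_shift[of 1 1 m k] two by (simp add: m add_ac del: fact_Suc) (simp add: fact_Suc[of m])
  have Gn: "Gamma (real n + 1 + \<mu>) = pochhammer (\<mu> + 1) n * Gamma (\<mu> + 1)"
    using G[of n] by (simp add: add_ac)
  have n_diff: "n - 1 = m" and sgn: "(-1 :: real) ^ n = - ((-1) ^ m)"
    by (simp_all add: m)
  have Gf: "Gamma (real n + 1) = fact n"
    using Gamma_fact[of n, where ?'a = real] by (simp add: add_ac)
  show "coeff (frac_pderiv \<mu> (jacobi_poly (-\<mu>) \<mu> n) \<circ>\<^sub>p [:-1, 1:]) k =
     coeff (smult (Gamma (real n + 1 + \<mu>) / Gamma (real n + 1) * ((real n + 1) / 2))
        (jacobi_poly 1 1 (n - 1)) \<circ>\<^sub>p [:-1, 1:]) k"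
    unfolding L' pcompose_smult coeff_smult Gn Gf n_diff R sgn
    by (simp del: fact_Suc pochhammer_Suc of_nat_Suc add: mult_ac)
qed

section \<open>Existence of the coefficients\<close>

text \<open>Triangular elimination from the top coefficient down. The bound is put on coefficients
  rather than on the degree, so that m = 0 means p = 0 and starts the induction.\<close>

lemma poly_in_graded_span:
  fixes Q :: "nat \<Rightarrow> 'a::field poly"
  assumes "\<And>n. degree (Q n) \<le> n" "\<And>n. coeff (Q n) n \<noteq> 0" "\<And>k. k \<ge> m \<Longrightarrow> coeff p k = 0"
  shows "\<exists>c. p = (\<Sum>n<m. smult (c n) (Q n))"
  using assms(3)
proof (induction m arbitrary: p)
  case 0
  then show ?case by (simp add: poly_eq_iff)
next
  case (Suc m)
  define a where "a = coeff p m / coeff (Q m) m"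
  have "coeff (p - smult a (Q m)) k = 0" if "k \<ge> m" for k
  proof (cases "k = m")
    case True
    then show ?thesis using assms(2)[of m] by (simp add: a_def)
  next
    case False
    then show ?thesis using that Suc.prems[of k] assms(1)[of m] by (simp add: coeff_eq_0)
  qed
  from Suc.IH[OF this] obtain c where c: "p - smult a (Q m) = (\<Sum>n<m. smult (c n) (Q n))"
    by auto
  have "p = (\<Sum>n<Suc m. smult ((c(m := a)) n) (Q n))"
    using c by (simp add: algebra_simps)
  then show ?case by blast
qed

lemma lagrange_poly_exists:
  fixes y :: "'i \<Rightarrow> 'a::field"
  assumes "finite A" "inj_on y A" "j \<in> A"
  shows "\<exists>l. degree l \<le> card A - 1 \<and> (\<forall>i\<in>A. poly l (y i) = (if i = j then 1 else 0))"
proof (intro exI conjI ballI)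
  let ?l = "\<Prod>i\<in>A - {j}. smult (1 / (y j - y i)) [:- y i, 1:]"
  have "degree ?l \<le> (\<Sum>i\<in>A - {j}. degree (smult (1 / (y j - y i)) [:- y i, 1:]))"
    using degree_prod_sum_le[of "A - {j}" "\<lambda>i. smult (1 / (y j - y i)) [:- y i, 1:]"] assms(1)
    by (simp only: comp_def finite_Diff)
  also have "\<dots> \<le> (\<Sum>i\<in>A - {j}. 1)"
    by (intro sum_mono order.trans[OF degree_smult_le]) simp
  finally show "degree ?l \<le> card A - 1"
    using assms by simp
  fix i assume i: "i \<in> A"
  show "poly ?l (y i) = (if i = j then 1 else 0)"
  proof (cases "i = j")
    case True
    have "poly ?l (y i) = (\<Prod>i\<in>A - {j}. 1)"
      unfolding poly_prod using assms True
      by (intro prod.cong) (auto simp: inj_on_def diff_divide_distrib[symmetric])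
    then show ?thesis using True by simp
  next
    case False
    then show ?thesis
      using i assms(1) by (auto simp: poly_prod intro!: bexI[of _ i])
  qed
qed

text \<open>For each j the conditions say that a combination of the (1,1) polynomials of degree 0 to
  N-2 takes the values of the j-th Lagrange polynomial at the nodes. Its expansion in this graded
  basis, divided by the nonzero weights \<open>w n\<close>, gives the column j.\<close>

lemma birkhoff_coeffs_exist:
  fixes y :: "nat \<Rightarrow> real"
  assumes "0 < \<mu>" "inj_on y {1..N-1}"
  shows "\<exists>b. birkhoff_coeffs \<mu> N y b"
proof -
  define w where "w n = Gamma (real n + 1 + \<mu>) / Gamma (real n + 1) * ((real n + 1) / 2)" for n
  have w: "w n \<noteq> 0" for n
    using assms(1) Gamma_real_nonzero[of "real n + 1 + \<mu>"] Gamma_real_nonzero[of "real n + 1"]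
    by (auto simp: w_def)
  have "\<exists>c. \<forall>i\<in>{1..N-1}. (\<Sum>n=1..N-1. c n * w n * poly (jacobi_poly 1 1 (n - 1)) (y i)) = (if i = j then 1 else 0)"
    if j: "j \<in> {1..N-1}" for j
  proof -
    obtain l where l: "degree l \<le> N - 1 - 1" "\<And>i. i \<in> {1..N-1} \<Longrightarrow> poly l (y i) = (if i = j then 1 else 0)"
      using lagrange_poly_exists[OF _ assms(2) j] by auto
    \<comment> \<open>The index j witnesses N-1 \<ge> 1, so the truncated subtraction in the degree
      bound is a true one.\<close>
    have "coeff l k = 0" if "k \<ge> N - 1" for k
      using l(1) that j by (intro coeff_eq_0) auto
    then obtain c where c: "l = (\<Sum>n<N-1. smult (c n) (jacobi_poly 1 1 n))"
      using poly_in_graded_span[of "jacobi_poly 1 1" "N - 1" l]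
        degree_jacobi_poly_le coeff_jacobi_poly_nonzero[of 1 1] by auto
    have "(\<Sum>n=1..N-1. c (n - 1) / w n * w n * poly (jacobi_poly 1 1 (n - 1)) x) = poly l x" for x
      unfolding c poly_sum by (rule sum.reindex_bij_witness[of _ Suc "\<lambda>n. n - 1"]) (auto simp: w)
    then show ?thesis
      using l(2) by (intro exI[of _ "\<lambda>n. c (n - 1) / w n"]) simp
  qed
  then have "\<forall>j\<in>{1..N-1}. \<exists>c. \<forall>i\<in>{1..N-1}.
      (\<Sum>n=1..N-1. c n * w n * poly (jacobi_poly 1 1 (n - 1)) (y i)) = (if i = j then 1 else 0)"
    by (intro ballI)
  from bchoice[OF this] obtain c where "\<forall>j\<in>{1..N-1}. \<forall>i\<in>{1..N-1}.
      (\<Sum>n=1..N-1. c j n * w n * poly (jacobi_poly 1 1 (n - 1)) (y i)) = (if i = j then 1 else 0)" ..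
  then have "birkhoff_coeffs \<mu> N y (\<lambda>n j. c j n)"
    unfolding birkhoff_coeffs_def w_def by (simp only: mult.assoc) blast
  then show ?thesis by blast
qed

section \<open>Uniqueness and the form of the interpolant\<close>

text \<open>The image of p-q has degree below \<open>card A\<close> but vanishes at
  \<open>card A\<close> distinct points, so it is zero. Then p-q is constant, and its value at 1 is
  0.\<close>

lemma frac_pderiv_interpolation_unique:
  fixes y :: "nat \<Rightarrow> real"
  assumes \<mu>: "0 < \<mu>" "\<mu> < 1" and A: "finite A" "inj_on y A" "A \<noteq> {}"
    and deg: "degree p \<le> card A" "degree q \<le> card A" and one: "poly p 1 = poly q 1"
    and eq: "\<And>i. i \<in> A \<Longrightarrow> poly (frac_pderiv \<mu> p) (y i) = poly (frac_pderiv \<mu> q) (y i)"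
  shows "p = q"
proof -
  let ?D = "frac_pderiv \<mu> (p - q)"
  have "degree ?D < card A"
    using degree_frac_pderiv[OF \<mu>, of "p - q"] degree_diff_le[OF deg] A card_gt_0_iff[of A] by linarith
  moreover have "card A = card (y ` A)"
    using A by (simp add: card_image)
  moreover have "poly ?D x = 0" if "x \<in> y ` A" for x
    using that eq by (auto simp: frac_pderiv_diff[OF \<mu>])
  ultimately have "?D = 0"
    using card_poly_roots_bound[of ?D] poly_roots_finite[of ?D]
      card_mono[of "{x. poly ?D x = 0}" "y ` A"] by fastforce
  from frac_pderiv_eq_0D[OF \<mu> this] obtain c where "p - q = [:c:]"
    by (rule degree_eq_zeroE)
  moreover from this have "c = 0"
    using one poly_diff[of p q 1] by simp
  ultimately show ?thesis by simp
qed

theorem theorem3p3: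
  fixes \<nu> \<mu> :: real and N :: nat and y :: "nat \<Rightarrow> real" and u :: "real \<Rightarrow> real"
  assumes "1 < \<nu>" and "\<nu> < 2" and "\<mu> = \<nu> - 1" and "N \<ge> 2"
    and "strict_mono_on {1..N-1} y" and "\<forall>j\<in>{1..N-1}. -1 < y j \<and> y j < 1"
    and "u (-1) = 0" and "u 1 = 0"
    and "\<forall>j\<in>{1..N-1}. rl_deriv_defined \<nu> u (y j)"
  shows "(\<exists>b. birkhoff_coeffs \<mu> N y b) \<and>
    (\<forall>b. birkhoff_coeffs \<mu> N y b \<longrightarrow>
      (\<forall>p. solves_birkhoff \<nu> N y u p \<longleftrightarrow>
        (\<forall>x\<in>{-1..1}. p x = (\<Sum>j=1..N-1. rl_deriv \<nu> u (y j) * birkhoff_basis \<mu> N b j x))))"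
proof (intro conjI allI impI)
  have \<mu>: "0 < \<mu>" "\<mu> < 1" and \<nu>: "\<nu> = \<mu> + 1" using assms(1-3) by auto
  have inj: "inj_on y {1..N-1}"
    using assms(5) by (rule strict_mono_on_imp_inj_on)
  show "\<exists>b. birkhoff_coeffs \<mu> N y b"
    using birkhoff_coeffs_exist[OF \<mu>(1) inj] .
  fix b p assume b: "birkhoff_coeffs \<mu> N y b"
  define P where "P = jacobi_poly (-\<mu>) \<mu>"
  define r where "r j = rl_deriv \<nu> u (y j)" for j
  \<comment> \<open>The polynomial factor of the claimed interpolant. Subtracting the values at 1
    forces q(1) = 0, and the operator annihilates these constants.\<close>
  define q where "q = (\<Sum>j=1..N-1. smult (r j) (\<Sum>n=1..N-1. smult (b n j) (P n - [:poly (P n) 1:])))"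
  have q: "(\<Sum>j=1..N-1. rl_deriv \<nu> u (y j) * birkhoff_basis \<mu> N b j x) = (x + 1) powr \<mu> * poly q x" for x
    by (simp add: q_def r_def P_def birkhoff_basis_def poly_sum sum_distrib_left mult_ac)
  have deg: "degree q \<le> N - 1"
    unfolding q_def P_def
    by (intro degree_sum_le order.trans[OF degree_smult_le] degree_diff_le)
       (auto intro: order.trans[OF degree_jacobi_poly_le])
  have one: "poly q 1 = 0"
    by (simp add: q_def poly_sum)
  have Dq: "poly (frac_pderiv \<mu> q) (y i) = r i" if i: "i \<in> {1..N-1}" for i
  proof -
    have *: "(\<Sum>n=1..N-1. b n j * poly (frac_pderiv \<mu> (P n)) (y i)) = (\<Sum>n=1..N-1. b n j *
        (Gamma (real n + 1 + \<mu>) / Gamma (real n + 1)) * ((real n + 1) / 2) * poly (jacobi_poly 1 1 (n - 1)) (y i))" for j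
      by (rule sum.cong) (simp_all add: P_def frac_pderiv_jacobi_poly[OF \<mu>])
    have "poly (frac_pderiv \<mu> q) (y i) = (\<Sum>j=1..N-1. r j * (\<Sum>n=1..N-1. b n j *
        (Gamma (real n + 1 + \<mu>) / Gamma (real n + 1)) * ((real n + 1) / 2) * poly (jacobi_poly 1 1 (n - 1)) (y i)))"
      unfolding q_def frac_pderiv_sum[OF \<mu>] frac_pderiv_smult[OF \<mu>] frac_pderiv_diff[OF \<mu>]
        frac_pderiv_const[OF \<mu>] poly_sum poly_smult diff_0_right * ..
    \<comment> \<open>The inner sums are exactly those of the coefficient conditions, so they form a
      Kronecker delta.\<close>
    also have "\<dots> = (\<Sum>j=1..N-1. if j = i then r j else 0)"
      using b i unfolding birkhoff_coeffs_def by (intro sum.cong) auto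
    also have "\<dots> = r i" using i by simp
    finally show ?thesis .
  qed
  have y: "-1 < y j" "y j < 1" if "j \<in> {1..N-1}" for j
    using assms(6) that by auto
  show "solves_birkhoff \<nu> N y u p \<longleftrightarrow>
        (\<forall>x\<in>{-1..1}. p x = (\<Sum>j=1..N-1. rl_deriv \<nu> u (y j) * birkhoff_basis \<mu> N b j x))"
    unfolding q
  proof
    \<comment> \<open>The polynomial factor of any solution shares with q its value at 1 and the
      values of its image at the N-1 nodes, so uniqueness applies.\<close>
    assume "solves_birkhoff \<nu> N y u p"
    then obtain q' where q': "degree q' \<le> N - 1" "\<And>x. x \<in> {-1..1} \<Longrightarrow> p x = (x + 1) powr \<mu> * poly q' x"
      and p1: "p 1 = 0" and D: "\<And>j. j \<in> {1..N-1} \<Longrightarrow> rl_deriv \<nu> p (y j) = r j"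
      using assms(3) by (auto simp: solves_birkhoff_def frac_poly_space_def r_def)
    have "poly q' 1 = poly q 1"
      using q'(2)[of 1] p1 one by simp
    moreover have "poly (frac_pderiv \<mu> q') (y j) = poly (frac_pderiv \<mu> q) (y j)" if "j \<in> {1..N-1}" for j
      using rl_deriv_frac_poly(2)[OF \<mu> q'(2) y[OF that]] D[OF that] Dq[OF that] by (simp add: \<nu>)
    ultimately have "q' = q"
      using q'(1) deg assms(4) by (intro frac_pderiv_interpolation_unique[OF \<mu> _ inj]) simp_all
    with q'(2) show "\<forall>x\<in>{-1..1}. p x = (x + 1) powr \<mu> * poly q x" by blast
  next
    assume p: "\<forall>x\<in>{-1..1}. p x = (x + 1) powr \<mu> * poly q x"
    have "p \<in> frac_poly_space (\<nu> - 1) N"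
      using p deg assms(3) by (auto simp: frac_poly_space_def)
    moreover have "p 1 = 0"
      using p one by simp
    moreover have "rl_deriv_defined \<nu> p (y j) \<and> rl_deriv \<nu> p (y j) = rl_deriv \<nu> u (y j)"
      if "j \<in> {1..N-1}" for j
      using rl_deriv_frac_poly[OF \<mu> _ y[OF that], of p q] p Dq[OF that] by (simp add: \<nu> r_def)
    ultimately show "solves_birkhoff \<nu> N y u p"
      by (simp add: solves_birkhoff_def)
  qed
qed

end
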